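(* Let $X$ be a real $n \times p$ matrix with $p < n$ and of full rank $p$. Let $U^T X = \begin{bmatrix} U_1 & U_2 \end{bmatrix}^T X = \begin{bmatrix} T \\ 0 \end{bmatrix}$ be the result of the Householder algorithm for QR factorization applied to $X$ (as described in the context), where $U$ is the $n\times n$ orthogonal matrix produced by the algorithm, $U_1$ is its first $p$ columns, $U_2$ is its last $n-p$ columns, $T$ is $p \times p$ and upper triangular, and the standard sign choice is made at each step of the algorithm. Then $T - X^{(p)}$ is non-singular, and for every $x \in \mathrm{col}(X)^{\perp}$, $$U_2^T x = x_{(p)} + X_{(p)} \left( T - X^{(p)} \right)^{-1} x^{(p)}.$$
   Context: For a matrix or column vector $A$ with $n$ rows, $A^{(k)}$ denotes the first $k$ rows of $A$ and $A_{(k)}$ the last $n-k$ rows. $\mathrm{col}(X)$ is the column space of $X$, and $\perp$ denotes orthogonal complement in $\mathbb{R}^n$ with the Euclidean inner product. $e_k$ is the $k$-th standard basis vector of $\mathbb{R}^n$, and $x_k$ is the $k$-th column of $X$. Householder algorithm. Put $G_0 = I_n$. For $k = 0, 1, \dots, p-1$, given $G_k$, choose a sign $d_{k+1} \in \{1,-1\}$ and define $$v_{k+1} = \begin{bmatrix} 0 \\ (G_k x_{k+1})_{(k)} \end{bmatrix} + d_{k+1} \left\| (G_k x_{k+1})_{(k)} \right\| e_{k+1} \in \mathbb{R}^n$$ (where the $0$ block has $k$ entries), $H_{k+1} = I_n - \frac{2}{\|v_{k+1}\|^2} v_{k+1} v_{k+1}^T$ if $v_{k+1} \neq 0$ and $H_{k+1}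 = I_n$ if $v_{k+1} = 0$, and $G_{k+1} = H_{k+1} G_k$. At the end $G_p = H_p \cdots H_2 H_1$ satisfies $G_p X = \begin{bmatrix} T \\ 0 \end{bmatrix}$ with $T$ a $p\times p$ upper triangular matrix, and $U = G_p^T = H_1 H_2 \cdots H_p$. The standard sign choice at step $k+1$ is $d_{k+1} = \mathrm{sgn}\big((G_k x_{k+1})_{k+1}\big)$, the sign of the $(k+1)$-st component of $G_k x_{k+1}$; if that component is $0$, $d_{k+1}$ may be either of $1,-1$. *)

theory Defs
  imports
    Complex_Main
    "Jordan_Normal_Form.Matrix"
    "Jordan_Normal_Form.VS_Connect"
    "Jordan_Normal_Form.DL_Rank"
    "Jordan_Normal_Form.Gauss_Jordan_Elimination"
begin

text \<open>Indices are 0-based: the column \<open>x\<^bsub>k+1\<^esub>\<close>, the basis vector \<open>e\<^bsub>k+1\<^esub>\<close>, the component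
  \<open>k + 1\<close> of a vector and the sign \<open>d\<^bsub>k+1\<^esub>\<close> are \<open>col X k\<close>, \<open>unit_vec n k\<close>, \<open>y $ k\<close> and \<open>d k\<close>.\<close>

definition head_rows :: "'a mat \<Rightarrow> nat \<Rightarrow> 'a mat" where
  "head_rows A k = mat_of_rows (dim_col A) (take k (rows A))"

definition tail_rows :: "'a mat \<Rightarrow> nat \<Rightarrow> 'a mat" where
  "tail_rows A k = mat_of_rows (dim_col A) (drop k (rows A))"

text \<open>\<open>vec_last\<close> takes the number of entries to keep, whereas \<open>tail_vec\<close> takes the number of
  entries to drop, which is the convention of \<open>v\<^bsub>(k)\<^esub>\<close>; \<open>v\<^bsup>(k)\<^esup>\<close> is \<open>vec_first v k\<close>.\<close>
definition tail_vec :: "'a vec \<Rightarrow> nat \<Rightarrow> 'a vec" where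
  "tail_vec v k = vec_last v (dim_vec v - k)"

definition euclid_norm :: "real vec \<Rightarrow> real" where
  "euclid_norm v = sqrt (v \<bullet> v)"

definition householder_vec :: "nat \<Rightarrow> nat \<Rightarrow> real \<Rightarrow> real vec \<Rightarrow> real vec" where
  "householder_vec n k s y =
     (0\<^sub>v k @\<^sub>v tail_vec y k) + (s * euclid_norm (tail_vec y k)) \<cdot>\<^sub>v unit_vec n k"

definition householder_mat :: "nat \<Rightarrow> real vec \<Rightarrow> real mat" where
  "householder_mat n v =
     (if v = 0\<^sub>v n then 1\<^sub>m n
      else 1\<^sub>m n - (2 / (euclid_norm v)\<^sup>2) \<cdot>\<^sub>m (mat_of_cols n [v] * mat_of_rows n [v]))"

primrec householder_G :: "real mat \<Rightarrow> (nat \<Rightarrow> real) \<Rightarrow> nat \<Rightarrow> real mat" where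
  "householder_G X d 0 = 1\<^sub>m (dim_row X)"
| "householder_G X d (Suc k) =
     householder_mat (dim_row X)
       (householder_vec (dim_row X) k (d k) (householder_G X d k *\<^sub>v col X k))
     * householder_G X d k"

text \<open>A zero component leaves the sign free, hence a predicate on \<open>d\<close> rather than a function.\<close>
definition standard_signs :: "real mat \<Rightarrow> (nat \<Rightarrow> real) \<Rightarrow> bool" where
  "standard_signs X d \<longleftrightarrow>
     (\<forall>k < dim_col X. d k \<in> {1, -1} \<and>
        (let y = householder_G X d k *\<^sub>v col X k in y $ k \<noteq> 0 \<longrightarrow> d k = sgn (y $ k)))"

text \<open>Consistency check of the above: the algorithm reduces \<open>X\<close> to upper triangular form.\<close>

lemma mult_householder_mat:
  assumes "v \<in> carrier_vec n" "z \<in> carrier_vec n" "i < n"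
  shows "(householder_mat n v *\<^sub>v z) $ i = z $ i - 2 * (v \<bullet> z) / (v \<bullet> v) * v $ i"
proof (cases "v = 0\<^sub>v n")
  case True
  then show ?thesis using assms by (simp add: householder_mat_def)
next
  case False
  have nn: "0 \<le> v \<bullet> v"
    by (auto simp: scalar_prod_def intro!: sum_nonneg)
  have "(householder_mat n v *\<^sub>v z) $ i =
      (\<Sum>j<n. ((if i = j then 1 else 0) - 2 / (v \<bullet> v) * (v $ i * v $ j)) * z $ j)"
    using assms False nn
    by (simp add: householder_mat_def euclid_norm_def scalar_prod_def row_def mat_of_cols_def
        mat_of_rows_def atLeast0LessThan)
  also have "\<dots> = (\<Sum>j<n. (if i = j then z $ j else 0)) - 2 / (v \<bullet> v) * v $ i * (\<Sum>j<n. v $ j * z $ j)"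
    unfolding sum_distrib_left sum_subtractf[symmetric]
    by (rule sum.cong) (auto simp: algebra_simps)
  also have "\<dots> = z $ i - 2 * (v \<bullet> z) / (v \<bullet> v) * v $ i"
    using assms by (simp add: scalar_prod_def atLeast0LessThan)
  finally show ?thesis .
qed

lemma householder_mat_carrier [simp]: "householder_mat n v \<in> carrier_mat n n"
  by (auto simp: householder_mat_def mat_of_cols_def mat_of_rows_def)

lemma householder_vec_carrier:
  assumes "y \<in> carrier_vec n" "k \<le> n"
  shows "householder_vec n k s y \<in> carrier_vec n"
  using assms by (intro carrier_vecI) (simp add: householder_vec_def)

lemma householder_vec_index:
  assumes "y \<in> carrier_vec n" "k < n" "i < n"
  shows "householder_vec n k s y $ i =
    (if i < k then 0 else y $ i) + (if i = k then s * euclid_norm (tail_vec y k) else 0)"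
  using assms by (auto simp: householder_vec_def tail_vec_def vec_last_def unit_vec_def)

lemma householder_G_carrier:
  "householder_G X d k \<in> carrier_mat (dim_row X) (dim_row X)"
  by (induction k) (simp_all add: mult_carrier_mat[OF householder_mat_carrier])

lemma householder_annihilates:
  fixes y :: "real vec"
  assumes y: "y \<in> carrier_vec n" and k: "k < n" and s: "s \<in> {1, -1}" and i: "k < i" "i < n"
  shows "(householder_mat n (householder_vec n k s y) *\<^sub>v y) $ i = 0"
proof -
  define v where "v = householder_vec n k s y"
  define a where "a = euclid_norm (tail_vec y k)"
  have v: "v \<in> carrier_vec n" using householder_vec_carrier y k by (simp add: v_def)
  have vi: "v $ j = (if j < k then 0 else y $ j) + (if j = k then s * a else 0)" if "j < n" for j
    using householder_vec_index[OF y k that] by (simp add: v_def a_def)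
  have tt: "tail_vec y k \<bullet> tail_vec y k = (\<Sum>j=k..<n. y $ j * y $ j)"
    using y k
    by (auto simp: tail_vec_def vec_last_def scalar_prod_def
        intro!: sum.reindex_bij_witness[where i = "\<lambda>j. j - k" and j = "\<lambda>j. k + j"])
  have aa: "a * a = (\<Sum>j=k..<n. y $ j * y $ j)"
    by (simp add: a_def euclid_norm_def tt sum_nonneg)
  have split: "sum f {0..<n} = sum f {0..<k} + f k + sum f {Suc k..<n}" for f :: "nat \<Rightarrow> real"
    using k by (metis add.assoc less_imp_le_nat sum.atLeastLessThan_concat sum.atLeast_Suc_lessThan zero_le)
  have aa': "a * a = y $ k * y $ k + (\<Sum>j=Suc k..<n. y $ j * y $ j)"
    using k by (simp add: aa sum.atLeast_Suc_lessThan)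
  have vy: "v \<bullet> y = a * a + s * a * y $ k"
    using y k by (simp add: scalar_prod_def split vi aa' algebra_simps)
  have "v \<bullet> v = (y $ k + s * a) * (y $ k + s * a) + (\<Sum>j=Suc k..<n. y $ j * y $ j)"
    using v k by (simp add: scalar_prod_def split vi algebra_simps)
  also have "\<dots> = 2 * (v \<bullet> y)"
    using s by (auto simp: vy aa' algebra_simps)
  finally have vv: "v \<bullet> v = 2 * (v \<bullet> y)" .
  show ?thesis
  proof (cases "v \<bullet> v = 0")
    case True
    then have "v $ i * v $ i = 0"
      using v i by (auto simp: scalar_prod_def sum_nonneg_eq_0_iff)
    with True show ?thesis
      using mult_householder_mat[OF v y i(2)] vi[OF i(2)] i by (simp add: v_def)
  next
    case False
    then show ?thesis
      using mult_householder_mat[OF v y i(2)] vi[OF i(2)] i vv by (simp add: v_def)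
  qed
qed

lemma householder_preserves:
  fixes y z :: "real vec"
  assumes y: "y \<in> carrier_vec n" and z: "z \<in> carrier_vec n" and k: "k < n"
    and zero: "\<And>i. k \<le> i \<Longrightarrow> i < n \<Longrightarrow> z $ i = 0" and i: "i < n"
  shows "(householder_mat n (householder_vec n k s y) *\<^sub>v z) $ i = z $ i"
proof -
  have "householder_vec n k s y \<bullet> z = 0"
    unfolding scalar_prod_def using z zero
    by (intro sum.neutral) (auto simp: householder_vec_index[OF y k] not_less)
  then show ?thesis
    using mult_householder_mat[OF householder_vec_carrier[OF y] z i] k by simp
qed

lemma householder_G_triangular:
  assumes X: "X \<in> carrier_mat n p" and p: "p \<le> n" and d: "standard_signs X d"
    and "k \<le> p" "j < k" "j < i" "i < n"
  shows "(householder_G X d k * X) $$ (i, j) = 0"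
  using assms(4-)
proof (induction k arbitrary: i)
  case (Suc k)
  define y where "y = householder_G X d k *\<^sub>v col X k"
  define H where "H = householder_mat n (householder_vec n k (d k) y)"
  define G where "G = householder_G X d k"
  have G: "G \<in> carrier_mat n n" using householder_G_carrier X by (auto simp: G_def)
  have H: "H \<in> carrier_mat n n" by (simp add: H_def)
  have y: "y \<in> carrier_vec n" using G X by (auto simp: y_def G_def[symmetric])
  have s: "d k \<in> {1, -1}" using d Suc.prems X by (auto simp: standard_signs_def)
  have z: "G *\<^sub>v col X j \<in> carrier_vec n" using G X by auto
  have "(householder_G X d (Suc k) * X) $$ (i, j) = ((H * G) * X) $$ (i, j)"
    using X by (simp add: H_def G_def y_def)
  also have "\<dots> = (H *\<^sub>v (G *\<^sub>v col X j)) $ i"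
    using H G X Suc.prems by (auto simp: assoc_mult_mat[OF H G X] mult_mat_vec_def)
  also have "\<dots> = 0"
  proof (cases "j = k")
    case True
    then show ?thesis
      using householder_annihilates[OF y _ s Suc.prems(3,4)] Suc.prems by (simp add: H_def G_def y_def)
  next
    case False
    have zz: "(G *\<^sub>v col X j) $ i' = 0" if "j < i'" "i' < n" for i'
      using Suc.IH[of i'] False Suc.prems that G X by (simp add: G_def)
    show ?thesis
      unfolding H_def
      using householder_preserves[OF y z, of k i] zz False Suc.prems p by simp
  qed
  finally show ?case .
qed simp

lemma householder_qr:
  assumes X: "X \<in> carrier_mat n p" and p: "p \<le> n" and d: "standard_signs X d"
  defines "R \<equiv> householder_G X d p * X"
  shows "R = head_rows R p @\<^sub>r 0\<^sub>m (n - p) p" "upper_triangular (head_rows R p)"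
proof -
  have R: "R \<in> carrier_mat n p"
    using mult_carrier_mat[OF householder_G_carrier[of X d p], of X p] X by (simp add: R_def)
  have z: "R $$ (i, j) = 0" if "j < i" "i < n" "j < p" for i j
    unfolding R_def using householder_G_triangular[OF X p d, of p j i] that by simp
  show "R = head_rows R p @\<^sub>r 0\<^sub>m (n - p) p"
    using R p by (intro eq_matI) (auto simp: append_rows_def head_rows_def mat_of_rows_def z)
  show "upper_triangular (head_rows R p)"
    using R p by (auto simp: head_rows_def mat_of_rows_def z)
qed

end

theory Submission
  imports Defs
begin

text \<open>Every \<open>G\<^sub>k z - z\<close> is a combination of the Householder vectors \<open>v\<^sub>1, \<dots>, v\<^sub>k\<close>, and these are
  in echelon form: \<open>v\<^sub>j\<close> vanishes above its \<open>j\<close>-th entry, which is nonzero because \<open>X\<close> has full rank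
  and the sign choice excludes cancellation. So if \<open>G\<^sub>p z\<close> and \<open>z\<close> agree in the first \<open>p\<close> entries,
  then every reflection fixes \<open>z\<close>, and \<open>G\<^sub>p z = z\<close>.

  If \<open>(T - X\<^bsup>(p)\<^esup>) c = 0\<close>, apply this to \<open>z = X c\<close>. For \<open>k\<close> the last index with \<open>c\<^sub>k \<noteq> 0\<close>, the
  tails of \<open>z = G\<^sub>k\<^sub>-\<^sub>1 z\<close> and \<open>c\<^sub>k G\<^sub>k\<^sub>-\<^sub>1 x\<^sub>k\<close> agree, so \<open>z\<close> is not orthogonal to \<open>v\<^sub>k\<close> and is moved by
  \<open>H\<^sub>k\<close>; hence \<open>c = 0\<close>. For \<open>x\<close> orthogonal to \<open>col X\<close>, the first \<open>p\<close> entries of \<open>G\<^sub>p x\<close> vanish, so with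
  \<open>c = (T - X\<^bsup>(p)\<^esup>)\<^sup>-\<^sup>1 x\<^bsup>(p)\<^esup>\<close> the same fact applies to \<open>z = x + X c\<close>; the remaining entries of
  \<open>G\<^sub>p z = z\<close> are the formula.\<close>

section \<open>Matrix and vector preliminaries\<close>

lemma scalar_prod_self_eq_0_iff:
  fixes v :: "real vec"
  assumes "v \<in> carrier_vec n"
  shows "v \<bullet> v = 0 \<longleftrightarrow> v = 0\<^sub>v n"
  using assms by (auto simp: scalar_prod_def sum_nonneg_eq_0_iff)

text \<open>The rank is the size of a maximal independent subset of the set of columns, so a
  repeated column would keep it below \<open>nc\<close>. Distinctness lets a kernel vector be read
  as a dependency of this set.\<close>

lemma (in vec_space) full_rank_distinct_cols:
  assumes A: "A \<in> carrier_mat n nc" and r: "rank A = nc"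
  shows "distinct (cols A)"
proof -
  obtain S where S: "maximal S (\<lambda>T. T \<subseteq> set (cols A) \<and> lin_indpt T)"
    using maximal_exists_superset[of "set (cols A)" "\<lambda>T. T \<subseteq> set (cols A) \<and> lin_indpt T" "{}"]
      finite_lin_indpt2[of "{}"] by auto
  then have "card S \<le> card (set (cols A))"
    by (simp add: card_mono maximal_def)
  moreover have "card S = length (cols A)"
    using rank_card_indpt[OF A S] r A by simp
  ultimately show ?thesis
    using card_length[of "cols A"] by (intro card_distinct) simp
qed

lemma (in vec_space) full_rank_mult_eq_0:
  assumes A: "A \<in> carrier_mat n nc" and r: "rank A = nc"
    and c: "c \<in> carrier_vec nc" and "A *\<^sub>v c = 0\<^sub>v n"
  shows "c = 0\<^sub>v nc"
  using lin_depI[OF A c _ assms(4)] full_rank_lin_indpt[OF A r] full_rank_distinct_cols[OF A r]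
  by blast

lemma head_rows_carrier: "A \<in> carrier_mat n m \<Longrightarrow> k \<le> n \<Longrightarrow> head_rows A k \<in> carrier_mat k m"
  by (auto simp: head_rows_def)

lemma tail_rows_carrier: "A \<in> carrier_mat n m \<Longrightarrow> tail_rows A k \<in> carrier_mat (n - k) m"
  by (auto simp: tail_rows_def)

lemma head_rows_mult_vec_index:
  assumes "A \<in> carrier_mat n m" "k \<le> n" "i < k"
  shows "(head_rows A k *\<^sub>v c) $ i = (A *\<^sub>v c) $ i"
proof -
  have "i < n" using assms by simp
  then have "take k (rows A) ! i = row A i" "row A i \<in> carrier_vec m" "i < length (take k (rows A))"
    using assms by auto
  then have "row (head_rows A k) i = row A i"
    using mat_of_rows_row[of i "take k (rows A)" m] assms(1) by (simp add: head_rows_def)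
  then show ?thesis
    using assms \<open>i < n\<close> carrier_matD[OF head_rows_carrier[OF assms(1,2)]] by simp
qed

lemma tail_rows_mult_vec_index:
  assumes "A \<in> carrier_mat n m" "k + i < n"
  shows "(tail_rows A k *\<^sub>v c) $ i = (A *\<^sub>v c) $ (k + i)"
  using assms mat_of_rows_row[of i "drop k (rows A)" m] by (simp add: tail_rows_def)

lemma transpose_mat_of_cols_drop_cols_transpose:
  assumes "A \<in> carrier_mat n m"
  shows "transpose_mat (mat_of_cols m (drop k (cols (transpose_mat A)))) = tail_rows A k"
  using assms by (simp add: tail_rows_def transpose_mat_of_cols)

text \<open>A trivial kernel makes the determinant nonzero. The same \<open>B\<close> is the
  two-sided inverse and the value of \<open>mat_inverse\<close>.\<close>

lemma invertible_mat_if_injective: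
  fixes A :: "'a :: field mat"
  assumes A: "A \<in> carrier_mat n n"
    and inj: "\<And>c. c \<in> carrier_vec n \<Longrightarrow> A *\<^sub>v c = 0\<^sub>v n \<Longrightarrow> c = 0\<^sub>v n"
  obtains B where "B \<in> carrier_mat n n" "A * B = 1\<^sub>m n" "B * A = 1\<^sub>m n" "mat_inverse A = Some B"
    "invertible_mat A"
proof -
  have "det A \<noteq> 0"
    using det_0_iff_vec_prod_zero_field[OF A] inj by blast
  then obtain B where B: "mat_inverse A = Some B"
    using det_non_zero_imp_unit[OF A, of undefined] mat_inverse(1)[OF A, of undefined]
    by (cases "mat_inverse A") auto
  have "A * B = 1\<^sub>m n \<and> B * A = 1\<^sub>m n \<and> B \<in> carrier_mat n n"
    using mat_inverse(2)[OF A B] .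
  moreover from this have "invertible_mat A"
    using A by (auto simp: invertible_mat_def inverts_mat_def)
  ultimately show thesis
    using that B by blast
qed

section \<open>Householder reflections\<close>

text \<open>This includes \<open>v = 0\<close>, where the matrix is the identity and the subtracted
  multiple vanishes.\<close>

lemma mult_householder_mat_vec:
  assumes "v \<in> carrier_vec n" "z \<in> carrier_vec n"
  shows "householder_mat n v *\<^sub>v z = z - (2 * (v \<bullet> z) / (v \<bullet> v)) \<cdot>\<^sub>v v"
proof (rule eq_vecI)
  fix i assume "i < dim_vec (z - (2 * (v \<bullet> z) / (v \<bullet> v)) \<cdot>\<^sub>v v)"
  then show "(householder_mat n v *\<^sub>v z) $ i = (z - (2 * (v \<bullet> z) / (v \<bullet> v)) \<cdot>\<^sub>v v) $ i"
    using assms mult_householder_mat[OF assms] by (simp del: index_mult_mat_vec)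
qed (use assms carrier_matD[OF householder_mat_carrier[of n v]] in simp)

lemma householder_mat_isometry:
  assumes v: "v \<in> carrier_vec n" and z: "z \<in> carrier_vec n" and w: "w \<in> carrier_vec n"
  shows "(householder_mat n v *\<^sub>v z) \<bullet> (householder_mat n v *\<^sub>v w) = z \<bullet> w"
proof -
  define a where "a = 2 * (v \<bullet> z) / (v \<bullet> v)"
  define b where "b = 2 * (v \<bullet> w) / (v \<bullet> v)"
  \<comment> \<open>This identity cancels the cross terms of the expanded product. If
    \<open>v \<bullet> v = 0\<close>, then \<open>a = b = 0\<close> by division by zero.\<close>
  have "a * b * (v \<bullet> v) = a * (v \<bullet> w) + b * (v \<bullet> z)"
    by (cases "v \<bullet> v = 0") (auto simp: a_def b_def field_simps)
  moreover have "(z - a \<cdot>\<^sub>v v) \<bullet> (w - b \<cdot>\<^sub>v v)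
      = z \<bullet> w - b * (v \<bullet> z) - a * (v \<bullet> w) + a * b * (v \<bullet> v)"
    using v z w comm_scalar_prod[OF v z]
    by (simp add: minus_scalar_prod_distrib[of _ n] scalar_prod_minus_distrib[of _ n] algebra_simps)
  ultimately show ?thesis
    unfolding mult_householder_mat_vec[OF v z] mult_householder_mat_vec[OF v w]
    by (simp add: a_def b_def)
qed

lemma euclid_norm_tail_vec_sq:
  assumes "y \<in> carrier_vec n"
  shows "(euclid_norm (tail_vec y k))\<^sup>2 = (\<Sum>j=k..<n. y $ j * y $ j)"
proof -
  have "tail_vec y k \<bullet> tail_vec y k = (\<Sum>j=k..<n. y $ j * y $ j)"
    using assms
    by (auto simp: tail_vec_def vec_last_def scalar_prod_def add.commute
        intro!: sum.reindex_bij_witness[where i = "\<lambda>j. j - k" and j = "\<lambda>j. k + j"])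
  then show ?thesis
    by (simp add: euclid_norm_def sum_nonneg)
qed

lemma householder_vec_scalar_prod:
  assumes y: "y \<in> carrier_vec n" and w: "w \<in> carrier_vec n" and k: "k < n"
  shows "householder_vec n k s y \<bullet> w
    = (\<Sum>j=k..<n. y $ j * w $ j) + s * euclid_norm (tail_vec y k) * w $ k"
proof -
  let ?a = "euclid_norm (tail_vec y k)"
  have "householder_vec n k s y \<bullet> w
      = (\<Sum>j=0..<n. (if j < k then 0 else y $ j * w $ j) + (if j = k then s * ?a * w $ k else 0))"
    unfolding scalar_prod_def using w
    by (intro sum.cong) (auto simp: householder_vec_index[OF y k] algebra_simps)
  also have "\<dots> = (\<Sum>j=0..<n. if j < k then 0 else y $ j * w $ j) + s * ?a * w $ k"
    using k by (simp add: sum.distrib)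
  also have "(\<Sum>j=0..<n. if j < k then 0 else y $ j * w $ j) = (\<Sum>j=k..<n. y $ j * w $ j)"
    using k by (intro sum.mono_neutral_cong_right) auto
  finally show ?thesis .
qed

text \<open>With \<open>a\<close> the norm of the tail, \<open>s * s = 1\<close> makes both sides
  \<open>2 * (a * a + s * a * y $ k)\<close>. Hence a nonzero Householder vector is never orthogonal
  to \<open>y\<close>.\<close>

lemma householder_vec_scalar_prod_self:
  assumes y: "y \<in> carrier_vec n" and k: "k < n" and s: "s \<in> {1, -1}"
  shows "householder_vec n k s y \<bullet> householder_vec n k s y = 2 * (householder_vec n k s y \<bullet> y)"
proof -
  let ?v = "householder_vec n k s y"
  let ?a = "euclid_norm (tail_vec y k)"
  have v: "?v \<in> carrier_vec n"
    using householder_vec_carrier[OF y] k by simp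
  have vy: "?v \<bullet> y = ?a\<^sup>2 + s * ?a * y $ k"
    using householder_vec_scalar_prod[OF y y k] euclid_norm_tail_vec_sq[OF y] by simp
  have "(\<Sum>j=k..<n. y $ j * ?v $ j) = (\<Sum>j=k..<n. y $ j * y $ j + (if j = k then s * ?a * y $ k else 0))"
    by (intro sum.cong) (auto simp: householder_vec_index[OF y k] algebra_simps)
  also have "\<dots> = ?v \<bullet> y"
    using k by (simp add: sum.distrib vy euclid_norm_tail_vec_sq[OF y])
  finally have "?v \<bullet> ?v = ?v \<bullet> y + s * ?a * (y $ k + s * ?a)"
    using householder_vec_scalar_prod[OF y v k] householder_vec_index[OF y k k] by simp
  also have "\<dots> = 2 * (?v \<bullet> y)"
    using s by (auto simp: vy power2_eq_square algebra_simps)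
  finally show ?thesis .
qed

text \<open>The pivot is \<open>y $ k\<close> plus \<open>s\<close> times the norm of the tail. The
  norm is positive by the nonzero entry \<open>i\<close>, and the two summands never have opposite
  signs.\<close>

lemma householder_vec_pivot_nonzero:
  assumes y: "y \<in> carrier_vec n" and k: "k < n" and s: "s \<in> {1, -1}"
    and sgn: "y $ k \<noteq> 0 \<Longrightarrow> s = sgn (y $ k)"
    and i: "k \<le> i" "i < n" "y $ i \<noteq> 0"
  shows "householder_vec n k s y $ k \<noteq> 0"
proof -
  let ?a = "euclid_norm (tail_vec y k)"
  have "0 < (\<Sum>j=k..<n. y $ j * y $ j)"
    using i by (intro sum_pos2[of _ i]) (auto simp: zero_less_mult_iff)
  then have "?a \<noteq> 0"
    using euclid_norm_tail_vec_sq[OF y, of k] by auto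
  moreover have "0 \<le> ?a"
    by (auto simp: euclid_norm_def scalar_prod_def intro!: sum_nonneg)
  ultimately have a: "0 < ?a" by simp
  consider "y $ k = 0" | "0 < y $ k" "s = 1" | "y $ k < 0" "s = - 1"
    using sgn by (metis linorder_neqE_linordered_idom sgn_neg sgn_pos)
  then show ?thesis
    unfolding householder_vec_index[OF y k k] using a s by cases auto
qed

section \<open>The Householder algorithm\<close>

context
  fixes n p :: nat and X :: "real mat" and d :: "nat \<Rightarrow> real"
  assumes p: "p < n" and X: "X \<in> carrier_mat n p" and d: "standard_signs X d"
begin

abbreviation (input) "G \<equiv> householder_G X d"
text \<open>With 0-based indices, \<open>hvec k\<close> is the vector v_{k+1} of the algorithm,
  which turns \<open>G k\<close> into \<open>G (Suc k)\<close> and has its pivot at entry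
  \<open>k\<close>.\<close>

abbreviation (input) "hvec k \<equiv> householder_vec n k (d k) (G k *\<^sub>v col X k)"

lemma G_carrier: "G k \<in> carrier_mat n n"
  using householder_G_carrier[of X d k] X by simp

lemma G_mult_carrier: "z \<in> carrier_vec n \<Longrightarrow> G k *\<^sub>v z \<in> carrier_vec n"
  using G_carrier by (rule mult_mat_vec_carrier)

lemma G_col_carrier: "G k *\<^sub>v col X j \<in> carrier_vec n"
  using G_mult_carrier[of "col X j" k] X by auto

lemma hvec_carrier: "k < p \<Longrightarrow> hvec k \<in> carrier_vec n"
  using householder_vec_carrier[OF G_col_carrier, of k] p by simp

lemma G_Suc_mult:
  assumes "z \<in> carrier_vec n"
  shows "G (Suc k) *\<^sub>v z = householder_mat n (hvec k) *\<^sub>v (G k *\<^sub>v z)"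
  using assms X assoc_mult_mat_vec[OF householder_mat_carrier G_carrier assms] by simp

lemma G_Suc_mult_index:
  assumes "z \<in> carrier_vec n" "k < p" "i < n"
  shows "(G (Suc k) *\<^sub>v z) $ i = (G k *\<^sub>v z) $ i
    - 2 * (hvec k \<bullet> (G k *\<^sub>v z)) / (hvec k \<bullet> hvec k) * hvec k $ i"
  using G_Suc_mult[OF assms(1)] mult_householder_mat[OF hvec_carrier G_mult_carrier] assms by simp

lemma G_isometry:
  assumes "z \<in> carrier_vec n" "w \<in> carrier_vec n" "k \<le> p"
  shows "(G k *\<^sub>v z) \<bullet> (G k *\<^sub>v w) = z \<bullet> w"
  using assms(3)
proof (induction k)
  case 0
  then show ?case using assms X by simp
next
  case (Suc k)
  then show ?case
    using assms
      householder_mat_isometry[OF hvec_carrier G_mult_carrier[OF assms(1)] G_mult_carrier[OF assms(2)]]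
    by (simp only: G_Suc_mult Suc_le_eq less_imp_le)
qed

text \<open>The vectors \<open>hvec j\<close>, \<open>hvec (Suc j)\<close>, ... vanish before entry
  \<open>j\<close>, so these steps leave the first \<open>j\<close> entries alone.\<close>

lemma G_mult_index_stable:
  assumes "z \<in> carrier_vec n" "j \<le> k" "k \<le> p" "i < j"
  shows "(G k *\<^sub>v z) $ i = (G j *\<^sub>v z) $ i"
  using assms(2,3)
proof (induction k rule: dec_induct)
  case (step k)
  then have k: "k < p" "k < n" "i < n" "i < k" using p assms(4) by auto
  have "hvec k $ i = 0"
    using householder_vec_index[OF G_col_carrier k(2,3)] k by simp
  then show ?case
    using step G_Suc_mult_index[OF assms(1) k(1,3)] by simp
qed simp

lemma G_mult_col_index_eq_0:
  assumes "j < k" "k \<le> p" "j < i" "i < n"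
  shows "(G k *\<^sub>v col X j) $ i = 0"
  using householder_G_triangular[OF X less_imp_le[OF p] d assms(2,1,3,4)] X G_carrier[of k] assms
  by (simp add: mult_mat_vec_def)

text \<open>From step \<open>j\<close> on, the Householder vectors are supported on entries where
  \<open>G j *\<^sub>v z\<close> vanishes, so all later reflections fix it.\<close>

lemma G_mult_fixed_if_tail_eq_0:
  assumes z: "z \<in> carrier_vec n" and jk: "j \<le> k" "k \<le> p"
    and tail: "\<And>i. j \<le> i \<Longrightarrow> i < n \<Longrightarrow> (G j *\<^sub>v z) $ i = 0"
  shows "G k *\<^sub>v z = G j *\<^sub>v z"
  using jk
proof (induction k rule: dec_induct)
  case (step k)
  then have k: "k < p" "k < n" using p by auto
  have eq: "G k *\<^sub>v z = G j *\<^sub>v z" using step by simp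
  have "G (Suc k) *\<^sub>v z = G k *\<^sub>v z"
  proof (rule eq_vecI)
    fix i assume "i < dim_vec (G k *\<^sub>v z)"
    then have "i < n" using carrier_matD(1)[OF G_carrier] by simp
    then show "(G (Suc k) *\<^sub>v z) $ i = (G k *\<^sub>v z) $ i"
      unfolding G_Suc_mult[OF z] using tail step.hyps(1)
      by (intro householder_preserves[OF G_col_carrier G_mult_carrier[OF z] k(2)]) (simp_all only: eq)
  qed (use carrier_matD(1)[OF G_carrier] in \<open>simp del: householder_G.simps\<close>)
  then show ?case using eq by simp
qed simp

section \<open>The triangularized matrix \<open>G p * X\<close>\<close>

lemma GX_carrier: "G p * X \<in> carrier_mat n p"
  using G_carrier X by (rule mult_carrier_mat)

lemma GX_mult: "c \<in> carrier_vec p \<Longrightarrow> (G p * X) *\<^sub>v c = G p *\<^sub>v (X *\<^sub>v c)"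
  by (rule assoc_mult_mat_vec[OF G_carrier X])

lemma GX_index: "i < n \<Longrightarrow> j < p \<Longrightarrow> (G p * X) $$ (i, j) = (G p *\<^sub>v col X j) $ i"
  using G_carrier[of p] X by (simp add: mult_mat_vec_def)

lemma GX_mult_bottom:
  assumes c: "c \<in> carrier_vec p" and i: "p \<le> i" "i < n"
  shows "(G p *\<^sub>v (X *\<^sub>v c)) $ i = 0"
proof -
  have "row (G p * X) i = 0\<^sub>v p"
    using GX_carrier i G_mult_col_index_eq_0[of _ p i]
    by (intro eq_vecI) (auto simp del: index_mult_mat simp: GX_index row_def)
  then have "((G p * X) *\<^sub>v c) $ i = 0"
    using carrier_matD(1)[OF GX_carrier] i c by (subst index_mult_mat_vec) auto
  then show ?thesis by (simp add: GX_mult[OF c])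
qed

section \<open>Consequences of full rank\<close>

context
  assumes rank: "vec_space.rank n X = p"
begin

text \<open>The rows of \<open>G p * X\<close> below T are zero, so \<open>T c = 0\<close> gives
  \<open>G p *\<^sub>v (X *\<^sub>v c) = 0\<close>. The isometry then gives
  \<open>X *\<^sub>v c = 0\<close>, and full rank gives \<open>c = 0\<close>.\<close>

lemma head_rows_GX_injective:
  assumes c: "c \<in> carrier_vec p" and "head_rows (G p * X) p *\<^sub>v c = 0\<^sub>v p"
  shows "c = 0\<^sub>v p"
proof -
  have Xc: "X *\<^sub>v c \<in> carrier_vec n" using X c by simp
  have "(G p *\<^sub>v (X *\<^sub>v c)) $ i = 0" if "i < n" for i
  proof (cases "i < p")
    case True
    then show ?thesis
      using head_rows_mult_vec_index[OF GX_carrier, of p i c] assms p by (simp add: GX_mult)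
  next
    case False
    then show ?thesis using GX_mult_bottom[OF c] that by simp
  qed
  then have "G p *\<^sub>v (X *\<^sub>v c) = 0\<^sub>v n"
    using carrier_matD(1)[OF G_carrier] by (intro eq_vecI) auto
  then have "(X *\<^sub>v c) \<bullet> (X *\<^sub>v c) = 0"
    using G_isometry[OF Xc Xc, of p] by simp
  then have "X *\<^sub>v c = 0\<^sub>v n"
    using scalar_prod_self_eq_0_iff[OF Xc] by simp
  then show ?thesis
    by (rule vec_space.full_rank_mult_eq_0[OF X rank c])
qed

text \<open>If the tail of column \<open>k\<close> vanished at step \<open>k\<close>, later
  reflections would fix that column and leave a zero on the diagonal of T, which is triangular and
  injective. So the tail is nonzero and the sign choice applies.\<close>

lemma pivot_nonzero:
  assumes k: "k < p"
  shows "hvec k $ k \<noteq> 0"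
proof -
  have "\<exists>i. k \<le> i \<and> i < n \<and> (G k *\<^sub>v col X k) $ i \<noteq> 0"
  proof (rule ccontr)
    assume "\<not> ?thesis"
    then have zero: "(G k *\<^sub>v col X k) $ i = 0" if "k \<le> i" "i < n" for i
      using that by blast
    let ?T = "head_rows (G p * X) p"
    have T: "?T \<in> carrier_mat p p"
      using head_rows_carrier[OF GX_carrier] p by simp
    have "G p *\<^sub>v col X k = G k *\<^sub>v col X k"
      using G_mult_fixed_if_tail_eq_0[OF _ _ _ zero, of p] k X
      by (metis col_dim carrier_matD(1) less_imp_le order_refl)
    then have "(G p * X) $$ (k, k) = 0"
      using zero[of k] GX_index[of k k] k p by simp
    then have "?T $$ (k, k) = 0"
      using head_rows_mult_vec_index[OF GX_carrier, of p k "unit_vec p k"] k p T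
        carrier_matD[OF GX_carrier]
      by (simp del: index_mult_mat row_mult)
    then have "0 \<in> set (diag_mat ?T)"
      using T k by (auto simp: diag_mat_def image_iff intro!: bexI[of _ k])
    then have "det ?T = 0"
      using upper_triangular_imp_det_eq_0_iff[OF T householder_qr(2)[OF X less_imp_le[OF p] d]] by simp
    then show False
      using det_0_iff_vec_prod_zero_field[OF T] head_rows_GX_injective by blast
  qed
  then show ?thesis
    using householder_vec_pivot_nonzero[OF G_col_carrier, of k "d k" k k] d k p X
    by (auto simp: standard_signs_def Let_def)
qed

lemma G_mult_fixed_if_head_eq:
  assumes z: "z \<in> carrier_vec n" and head: "\<And>i. i < p \<Longrightarrow> (G p *\<^sub>v z) $ i = z $ i" and k: "k \<le> p"
  shows "G k *\<^sub>v z = z" and "k < p \<Longrightarrow> hvec k \<bullet> z = 0"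
proof -
  have coef: "hvec k \<bullet> z = 0" if k: "k < p" and fixed: "G k *\<^sub>v z = z" for k
  proof -
    have kn: "k < n" using k p by simp
    \<comment> \<open>Entry \<open>k\<close> is final after step \<open>k\<close>, while that step
      changes it by a multiple of the nonzero pivot; so the multiple is zero.\<close>
    have "(G (Suc k) *\<^sub>v z) $ k = z $ k"
      using G_mult_index_stable[OF z, of "Suc k" p k] head[OF k] k by simp
    then have "hvec k \<bullet> z = 0 \<or> hvec k \<bullet> hvec k = 0"
      using G_Suc_mult_index[OF z k kn] pivot_nonzero[OF k] fixed by simp
    moreover have "hvec k \<bullet> hvec k \<noteq> 0"
      using scalar_prod_self_eq_0_iff[OF hvec_carrier[OF k]] pivot_nonzero[OF k] kn by auto
    ultimately show ?thesis by blast
  qed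
  have all: "G k *\<^sub>v z = z" if "k \<le> p" for k
    using that
  proof (induction k)
    case 0
    then show ?case using z X by simp
  next
    case (Suc k)
    then have k: "k < p" and fixed: "G k *\<^sub>v z = z" by auto
    show ?case
      using G_mult_carrier[OF z, of "Suc k"] z G_Suc_mult_index[OF z k] coef[OF k fixed]
      by (intro eq_vecI) (auto simp only: fixed carrier_vecD)
  qed
  show "G k *\<^sub>v z = z" using all k .
  show "k < p \<Longrightarrow> hvec k \<bullet> z = 0" using coef all by simp
qed

text \<open>The hypothesis is \<open>(T - head_rows X p) *\<^sub>v c = 0\<close> entry by
  entry.\<close>

lemma GX_minus_X_injective:
  assumes c: "c \<in> carrier_vec p"
    and head: "\<And>i. i < p \<Longrightarrow> (G p *\<^sub>v (X *\<^sub>v c)) $ i = (X *\<^sub>v c) $ i"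
  shows "c = 0\<^sub>v p"
proof (rule ccontr)
  assume "c \<noteq> 0\<^sub>v p"
  then have ex: "\<exists>k. k < p \<and> c $ k \<noteq> 0"
    using c by (metis carrier_vecD eq_vecI index_zero_vec(1,2))
  define k where "k = (GREATEST k. k < p \<and> c $ k \<noteq> 0)"
  have k: "k < p" "c $ k \<noteq> 0"
    using GreatestI_ex_nat[OF ex, of p] by (auto simp: k_def)
  have above: "c $ j = 0" if "k < j" "j < p" for j
    using Greatest_le_nat[of "\<lambda>k. k < p \<and> c $ k \<noteq> 0" j p] that by (force simp: k_def)
  have kn: "k < n" using k p by simp
  define z where "z = X *\<^sub>v c"
  have z: "z \<in> carrier_vec n" using X c by (simp add: z_def)
  note fixed = G_mult_fixed_if_head_eq[OF z head[folded z_def], of k]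
  let ?y = "G k *\<^sub>v col X k"
  \<comment> \<open>Columns before \<open>k\<close> are already zero from entry \<open>k\<close> on,
    and columns after \<open>k\<close> have coefficient zero.\<close>
  have tail: "z $ i = c $ k * ?y $ i" if i: "k \<le> i" "i < n" for i
  proof -
    have "z $ i = ((G k * X) *\<^sub>v c) $ i"
      using fixed(1) k assoc_mult_mat_vec[OF G_carrier X c] by (simp add: z_def)
    also have "\<dots> = (\<Sum>j=0..<p. (G k *\<^sub>v col X j) $ i * c $ j)"
      using carrier_matD[OF G_carrier[of k]] X c i
      by (simp add: scalar_prod_def[of _ c] assoc_mult_mat_vec[OF G_carrier X c, symmetric]
          del: assoc_mult_mat_vec)
    also have "\<dots> = (\<Sum>j\<in>{k}. (G k *\<^sub>v col X j) $ i * c $ j)"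
    proof (intro sum.mono_neutral_right ballI)
      fix j assume j: "j \<in> {0..<p} - {k}"
      show "(G k *\<^sub>v col X j) $ i * c $ j = 0"
        using G_mult_col_index_eq_0[of j k i] above[of j] j i k by (cases "j < k") auto
    qed (use k in auto)
    finally show ?thesis by simp
  qed
  have "hvec k \<bullet> z = c $ k * (hvec k \<bullet> ?y)"
    unfolding householder_vec_scalar_prod[OF G_col_carrier z kn]
      householder_vec_scalar_prod[OF G_col_carrier G_col_carrier kn]
    using tail kn by (simp add: sum_distrib_left algebra_simps)
  then have "hvec k \<bullet> ?y = 0"
    using fixed(2) k by simp
  \<comment> \<open>The squared norm is twice the product with \<open>?y\<close>, so
    \<open>hvec k\<close> would vanish together with its pivot.\<close>
  then have "hvec k \<bullet> hvec k = 0"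
    using householder_vec_scalar_prod_self[OF G_col_carrier kn] d k X
    by (auto simp: standard_signs_def)
  then show False
    using scalar_prod_self_eq_0_iff[OF hvec_carrier[OF k(1)]] pivot_nonzero[OF k(1)] kn by auto
qed

text \<open>Column \<open>i\<close> of U lies in the column space of X: since T is invertible, some
  \<open>c\<close> has \<open>G p *\<^sub>v (X *\<^sub>v c) = unit_vec n i\<close>. The isometry
  turns entry \<open>i\<close> of \<open>G p *\<^sub>v x\<close> into
  \<open>x \<bullet> (X *\<^sub>v c)\<close>.\<close>

lemma G_mult_head_eq_0:
  assumes x: "x \<in> carrier_vec n" and orth: "\<And>c. c \<in> carrier_vec p \<Longrightarrow> x \<bullet> (X *\<^sub>v c) = 0"
    and i: "i < p"
  shows "(G p *\<^sub>v x) $ i = 0"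
proof -
  let ?T = "head_rows (G p * X) p"
  have T: "?T \<in> carrier_mat p p"
    using head_rows_carrier[OF GX_carrier] p by simp
  obtain B where B: "B \<in> carrier_mat p p" "?T * B = 1\<^sub>m p"
    using invertible_mat_if_injective[OF T head_rows_GX_injective] by blast
  define c where "c = B *\<^sub>v unit_vec p i"
  have c: "c \<in> carrier_vec p" using B by (simp add: c_def)
  have Tc: "?T *\<^sub>v c = unit_vec p i"
    using assoc_mult_mat_vec[OF T B(1), of "unit_vec p i"] B(2) by (simp add: c_def)
  have Xc: "X *\<^sub>v c \<in> carrier_vec n" using X c by simp
  have "G p *\<^sub>v (X *\<^sub>v c) = unit_vec n i"
  proof (intro eq_vecI)
    fix j assume "j < dim_vec (unit_vec n i :: real vec)"
    then have j: "j < n" by simp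
    show "(G p *\<^sub>v (X *\<^sub>v c)) $ j = unit_vec n i $ j"
    proof (cases "j < p")
      case True
      then show ?thesis
        using head_rows_mult_vec_index[OF GX_carrier, of p j c] Tc p i by (simp add: GX_mult[OF c])
    next
      case False
      then show ?thesis using GX_mult_bottom[OF c, of j] j i by simp
    qed
  qed (use carrier_matD(1)[OF G_carrier] in simp)
  then have "(G p *\<^sub>v x) \<bullet> unit_vec n i = x \<bullet> (X *\<^sub>v c)"
    using G_isometry[OF x Xc, of p] by simp
  then show ?thesis
    using orth[OF c] G_mult_carrier[OF x, of p] i p by simp
qed

lemma G_mult_tail_orthogonal:
  assumes x: "x \<in> carrier_vec n" and orth: "\<And>c. c \<in> carrier_vec p \<Longrightarrow> x \<bullet> (X *\<^sub>v c) = 0"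
    and c: "c \<in> carrier_vec p"
    and head: "\<And>i. i < p \<Longrightarrow> (G p *\<^sub>v (X *\<^sub>v c)) $ i - (X *\<^sub>v c) $ i = x $ i"
    and i: "p \<le> i" "i < n"
  shows "(G p *\<^sub>v x) $ i = x $ i + (X *\<^sub>v c) $ i"
proof -
  have Xc: "X *\<^sub>v c \<in> carrier_vec n" using X c by simp
  have G_add: "(G p *\<^sub>v (x + X *\<^sub>v c)) $ j = (G p *\<^sub>v x) $ j + (G p *\<^sub>v (X *\<^sub>v c)) $ j" if "j < n" for j
    using mult_add_distrib_mat_vec[OF G_carrier x Xc] carrier_matD(1)[OF G_carrier[of p]] that by simp
  \<comment> \<open>In the first \<open>p\<close> entries \<open>G p *\<^sub>v x\<close> is zero, so
    \<open>head\<close> says exactly that both sides agree there.\<close>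
  have "G p *\<^sub>v (x + X *\<^sub>v c) = x + X *\<^sub>v c"
  proof (rule G_mult_fixed_if_head_eq(1))
    fix j assume j: "j < p"
    then have "j < n" using p by simp
    then show "(G p *\<^sub>v (x + X *\<^sub>v c)) $ j = (x + X *\<^sub>v c) $ j"
      using G_add[of j] G_mult_head_eq_0[OF x orth j] head[OF j] carrier_vecD[OF x] carrier_vecD[OF Xc]
      by (simp del: index_mult_mat_vec dim_mult_mat_vec)
  qed (use x Xc in auto)
  then show ?thesis
    using G_add[OF i(2)] GX_mult_bottom[OF c i] i carrier_vecD[OF x] carrier_vecD[OF Xc]
    by (simp del: index_mult_mat_vec dim_mult_mat_vec)
qed

end

end

theorem theorem1:
  fixes n p :: nat and X U U\<^sub>2 T :: "real mat" and d :: "nat \<Rightarrow> real"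
  assumes "p < n"
    and "X \<in> carrier_mat n p"
    and "vec_space.rank n X = p"
    and "standard_signs X d"
    and "U = transpose_mat (householder_G X d p)"
    and "U\<^sub>2 = mat_of_cols n (drop p (cols U))"
    and "T = head_rows (transpose_mat U * X) p"
  shows "invertible_mat (T - head_rows X p) \<and>
    (\<forall>x \<in> vec_module.orthogonal_complement n (vec_space.col_space n X).
       transpose_mat U\<^sub>2 *\<^sub>v x =
         tail_vec x p + tail_rows X p *\<^sub>v (the (mat_inverse (T - head_rows X p)) *\<^sub>v vec_first x p))"
proof (intro conjI ballI)
  note p = assms(1) and X = assms(2) and rank = assms(3) and d = assms(4)
  define M where "M = T - head_rows X p"
  have GX: "householder_G X d p * X \<in> carrier_mat n p"
    by (rule GX_carrier[OF p X d])
  have G: "householder_G X d p \<in> carrier_mat n n"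
    by (rule G_carrier[OF p X d])
  have T: "T = head_rows (householder_G X d p * X) p"
    using assms(5,7) by simp
  have T_carrier: "T \<in> carrier_mat p p" and hX: "head_rows X p \<in> carrier_mat p p"
    using head_rows_carrier[OF GX] head_rows_carrier[OF X] p by (simp_all add: T)
  then have M: "M \<in> carrier_mat p p" by (simp add: M_def minus_carrier_mat)
  have M_index: "(M *\<^sub>v c) $ i = (householder_G X d p *\<^sub>v (X *\<^sub>v c)) $ i - (X *\<^sub>v c) $ i"
    if "c \<in> carrier_vec p" "i < p" for c i
    using minus_mult_distrib_mat_vec[OF T_carrier hX that(1)] T_carrier hX that p
      head_rows_mult_vec_index[OF GX, of p i c] head_rows_mult_vec_index[OF X, of p i c]
      GX_mult[OF p X d that(1)]
    by (simp add: M_def T)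
  have "c = 0\<^sub>v p" if c: "c \<in> carrier_vec p" and "M *\<^sub>v c = 0\<^sub>v p" for c
    using GX_minus_X_injective[OF p X d rank c] M_index[OF c] that(2) by simp
  then obtain B where B: "B \<in> carrier_mat p p" "M * B = 1\<^sub>m p" "mat_inverse M = Some B"
      "invertible_mat M"
    using invertible_mat_if_injective[OF M] by blast
  show "invertible_mat (T - head_rows X p)"
    using B(4) by (simp add: M_def)
  fix x assume "x \<in> vec_module.orthogonal_complement n (vec_space.col_space n X)"
  then have x: "x \<in> carrier_vec n" and col: "\<forall>y \<in> vec_space.col_space n X. x \<bullet> y = 0"
    by (simp_all add: vec_module.orthogonal_complement_def)
  have orth: "x \<bullet> (X *\<^sub>v c) = 0" if "c \<in> carrier_vec p" for c
  proof -
    have "X *\<^sub>v c \<in> vec_space.col_space n X"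
      unfolding vec_space.col_space_eq[OF X] using that X by auto
    then show ?thesis using col by blast
  qed
  define c where "c = B *\<^sub>v vec_first x p"
  have c: "c \<in> carrier_vec p" using B by (simp add: c_def)
  have "M *\<^sub>v c = vec_first x p"
    using assoc_mult_mat_vec[OF M B(1), of "vec_first x p"] B(2) by (simp add: c_def)
  then have head: "(householder_G X d p *\<^sub>v (X *\<^sub>v c)) $ i - (X *\<^sub>v c) $ i = x $ i" if "i < p" for i
    using M_index[OF c that] that by (simp add: vec_first_def)
  \<comment> \<open>Since U is the transpose of \<open>householder_G X d p\<close>, its last columns
    are the last rows of that matrix.\<close>
  have U\<^sub>2: "transpose_mat U\<^sub>2 = tail_rows (householder_G X d p) p"
    unfolding assms(5,6) by (rule transpose_mat_of_cols_drop_cols_transpose[OF G])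
  have "transpose_mat U\<^sub>2 *\<^sub>v x = tail_vec x p + tail_rows X p *\<^sub>v c"
  proof (rule eq_vecI)
    fix i assume "i < dim_vec (tail_vec x p + tail_rows X p *\<^sub>v c)"
    then have i: "i < n - p" using X by (simp add: tail_rows_def)
    have "(transpose_mat U\<^sub>2 *\<^sub>v x) $ i = (householder_G X d p *\<^sub>v x) $ (p + i)"
      using tail_rows_mult_vec_index[OF G, of p i x] i by (simp add: U\<^sub>2)
    also have "\<dots> = x $ (p + i) + (X *\<^sub>v c) $ (p + i)"
      using i by (intro G_mult_tail_orthogonal[OF p X d rank x orth c head]) auto
    also have "\<dots> = (tail_vec x p + tail_rows X p *\<^sub>v c) $ i"
      using tail_rows_mult_vec_index[OF X, of p i c] tail_rows_carrier[OF X, of p] i x p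
      by (simp add: tail_vec_def vec_last_def)
    finally show "(transpose_mat U\<^sub>2 *\<^sub>v x) $ i = (tail_vec x p + tail_rows X p *\<^sub>v c) $ i" .
  qed (use tail_rows_carrier[OF X, of p] tail_rows_carrier[OF G, of p] in \<open>auto simp: U\<^sub>2\<close>)
  then show "transpose_mat U\<^sub>2 *\<^sub>v x =
      tail_vec x p + tail_rows X p *\<^sub>v (the (mat_inverse (T - head_rows X p)) *\<^sub>v vec_first x p)"
    using B(3) by (simp add: M_def c_def)
qed

end
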